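(* Let $\mathcal{C}$ be a binary linear code of length $n$ and dimension $2$. Then $\rho(\mathcal{C})=n-2$, i.e. $\mathcal{C}$ is of class at least $2$, where $\rho$ (and the class) is taken with respect to any one of the AWGNC pseudoweight, the BSC pseudoweight, or the max-fractional weight; that is, $\rho_{\mathrm{AWGNC}}(\mathcal{C})=\rho_{\mathrm{BSC}}(\mathcal{C})=\rho_{\mathrm{maxfrac}}(\mathcal{C})=n-2$.
   Context: A binary linear code of length $n$ is a linear subspace $\mathcal{C}\subseteq\mathbb{F}_2^n$; $d(\mathcal{C})$ is its minimum Hamming distance. A parity-check matrix of $\mathcal{C}$ is any $m\times n$ matrix $H$ over $\mathbb{F}_2$ (any $m\ge 0$, redundant rows allowed) with $\mathcal{C}=\ker H=\{c\in\mathbb{F}_2^n : Hc^T=0\}$. Put $\mathcal{I}=\{1,\dots,n\}$, $\mathcal{J}=\{1,\dots,m\}$, and $\mathcal{I}_j=\{i\in\mathcal{I}: H_{j,i}\ne 0\}$ for $j\in\mathcal{J}$. The fundamental cone $\mathcal{K}(H)$ is the set of $x\in\mathbb{R}^n$ with $x_i\ge 0$ for all $i\in\mathcal{I}$ and $x_\ell\le\sum_{i\in\mathcal{I}_j\setminus\{\ell\}}x_i$ for all $j\in\mathcal{J}$, $\ell\in\mathcal{I}_j$ (an empty sum is $0$). For nonzero $x\in\mathcal{K}(H)$ define: $w_{\mathrm{AWGNC}}(x)=\left(\sum_i x_i\right)^2/\sum_i x_i^2$; $w_{\mathrm{maxfrac}}(x)=\left(\sum_i x_i\right)/\max_i x_i$;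 and $w_{\mathrm{BSC}}(x)=2\,\Phi^{-1}(\Phi(n)/2)$, where $x'$ is $x$ with its components rearranged in non-increasing order, $\phi(\xi)=x'_i$ for $i-1<\xi\le i$ ($1\le i\le n$), and $\Phi(\xi)=\int_0^\xi\phi(\xi')\,d\xi'$ (i.e. $\Phi^{-1}(\Phi(n)/2)$ is the unique $\xi\in[0,n]$ with $\Phi(\xi)=\Phi(n)/2$). For each type of weight $w$, the minimum pseudoweight is $w^{\min}(H)=\min_{x\in\mathcal{K}(H)\setminus\{0\}}w(x)$, and the corresponding pseudocodeword redundancy is $\rho(\mathcal{C})=\inf\{\#\mathrm{rows}(H) : \ker H=\mathcal{C},\ w^{\min}(H)=d(\mathcal{C})\}$, with $\inf\varnothing=\infty$. Classes: with $r=n-\dim\mathcal{C}$, a code is in class 0 if $\rho(\mathcal{C})=\infty$; class 1 if $r<\rho(\mathcal{C})<\infty$; class 3 if $w^{\min}(H)=d(\mathcal{C})$ for every parity-check matrix $H$ of $\mathcal{C}$; class 2 if $\rho(\mathcal{C})=r$ but it is not in class 3. "Class at least 2" means class 2 or class 3, i.e. $\rho(\mathcal{C})=r$. *)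

theory Defs
  imports "HOL-Analysis.Analysis" "HOL-Library.Z2" "HOL-Library.Extended_Nat"
begin

text \<open>
  The field with two elements is \<^typ>\<open>bit\<close>. Coordinates are indexed by a finite type
  \<open>'n\<close>, so a code of length \<open>n = CARD('n)\<close> is a set \<open>C :: (bit ^ 'n) set\<close> with
  \<open>vec.subspace C\<close>, and its dimension is \<open>vec.dim C\<close>.

  The number of rows of a parity-check matrix varies (and may be zero), so an \<open>m \<times> n\<close> matrix over
  \<^typ>\<open>bit\<close> is the list of its \<open>m\<close> rows; its entry in row \<open>j\<close> (counted from \<open>0\<close>) and column \<open>i\<close>
  is \<open>H ! j $ i\<close>.
\<close>

definition hamming_dist :: "bit ^ 'n \<Rightarrow> bit ^ 'n \<Rightarrow> nat" where
  "hamming_dist x y = card {i. x $ i \<noteq> y $ i}"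

definition min_dist :: "(bit ^ 'n) set \<Rightarrow> nat" where
  "min_dist C = Min {hamming_dist x y | x y. x \<in> C \<and> y \<in> C \<and> x \<noteq> y}"

definition mat_ker :: "(bit ^ 'n) list \<Rightarrow> (bit ^ 'n) set" where
  "mat_ker H = {c. \<forall>j < length H. (\<Sum>i\<in>UNIV. H ! j $ i * c $ i) = 0}"

definition is_parity_check :: "(bit ^ 'n) list \<Rightarrow> (bit ^ 'n) set \<Rightarrow> bool" where
  "is_parity_check H C \<longleftrightarrow> mat_ker H = C"

definition row_supp :: "(bit ^ 'n) list \<Rightarrow> nat \<Rightarrow> 'n set" where
  "row_supp H j = {i. H ! j $ i \<noteq> 0}"

definition fundamental_cone :: "(bit ^ 'n) list \<Rightarrow> (real ^ 'n) set" where
  "fundamental_cone H = {x. (\<forall>i. x $ i \<ge> 0) \<and>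
     (\<forall>j < length H. \<forall>l \<in> row_supp H j. x $ l \<le> (\<Sum>i \<in> row_supp H j - {l}. x $ i))}"

definition w_AWGNC :: "real ^ 'n \<Rightarrow> real" where
  "w_AWGNC x = (\<Sum>i\<in>UNIV. x $ i)\<^sup>2 / (\<Sum>i\<in>UNIV. (x $ i)\<^sup>2)"

definition w_maxfrac :: "real ^ 'n \<Rightarrow> real" where
  "w_maxfrac x = (\<Sum>i\<in>UNIV. x $ i) / Max (range (\<lambda>i. x $ i))"

definition decr_rearr :: "real ^ 'n \<Rightarrow> real list" where
  "decr_rearr x = rev (sorted_list_of_multiset (image_mset (\<lambda>i. x $ i) (mset_set UNIV)))"

text \<open>For \<open>i - 1 < \<xi> \<le> i\<close> the (1-based) index \<open>i\<close> is \<open>\<lceil>\<xi>\<rceil>\<close>; lists are indexed from \<open>0\<close>. The value \<open>0\<close>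
  outside \<open>(0, n]\<close> is a dummy that does not affect the integrals below.\<close>

definition bsc_phi :: "real ^ 'n \<Rightarrow> real \<Rightarrow> real" where
  "bsc_phi x \<xi> = (if 0 < \<xi> \<and> \<xi> \<le> real CARD('n) then decr_rearr x ! (nat \<lceil>\<xi>\<rceil> - 1) else 0)"

definition bsc_Phi :: "real ^ 'n \<Rightarrow> real \<Rightarrow> real" where
  "bsc_Phi x \<xi> = integral {0..\<xi>} (bsc_phi x)"

definition w_BSC :: "real ^ 'n \<Rightarrow> real" where
  "w_BSC x = 2 * (THE \<xi>. \<xi> \<in> {0..real CARD('n)} \<and>
                         bsc_Phi x \<xi> = bsc_Phi x (real CARD('n)) / 2)"

text \<open>\<open>Least\<close> is the minimum of the set of values; it is attained for each of the three weights whenever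
  the cone is not \<open>{0}\<close>, since they are continuous and invariant under positive scaling.\<close>

definition min_pseudoweight :: "(real ^ 'n \<Rightarrow> real) \<Rightarrow> (bit ^ 'n) list \<Rightarrow> real" where
  "min_pseudoweight w H = (LEAST t. t \<in> w ` (fundamental_cone H - {0}))"

text \<open>The infimum of the empty set in \<^typ>\<open>enat\<close> is \<open>\<infinity>\<close>.\<close>

definition redundancy :: "(real ^ 'n \<Rightarrow> real) \<Rightarrow> (bit ^ 'n) set \<Rightarrow> enat" where
  "redundancy w C = Inf {enat (length H) | H.
     is_parity_check H C \<and> min_pseudoweight w H = real (min_dist C)}"

definition class3 :: "(real ^ 'n \<Rightarrow> real) \<Rightarrow> (bit ^ 'n) set \<Rightarrow> bool" where
  "class3 w C \<longleftrightarrow> (\<forall>H. is_parity_check H C \<longrightarrow> min_pseudoweight w H = real (min_dist C))"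

definition class2 :: "(real ^ 'n \<Rightarrow> real) \<Rightarrow> (bit ^ 'n) set \<Rightarrow> bool" where
  "class2 w C \<longleftrightarrow> redundancy w C = enat (CARD('n) - vec.dim C) \<and> \<not> class3 w C"

definition class_at_least_2 :: "(real ^ 'n \<Rightarrow> real) \<Rightarrow> (bit ^ 'n) set \<Rightarrow> bool" where
  "class_at_least_2 w C \<longleftrightarrow> class2 w C \<or> class3 w C"

end

theory Submission
  imports Defs
begin

text \<open>
  Sort the coordinates by the pair \<open>(a $ i, b $ i)\<close>, where \<open>a, b\<close> is a basis of the code. Equating coordinates of
  the same nonzero type, deleting those of type \<open>(0, 0)\<close>, and adding one check of weight three through the three
  nonzero types (if all occur) gives a parity-check matrix with \<open>n - 2\<close> rows. On its fundamental cone \<open>x\<close> takes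
  values \<open>\<alpha>, \<beta>, \<gamma>\<close> on the three types that obey the triangle inequalities, so the cone is spanned by the
  codewords and \<open>d x\<^sub>l \<le> \<Sum>\<^sub>i x\<^sub>i\<close> for every \<open>l\<close>. Thus the max-fractional weight is at least \<open>d\<close>, and the other two
  weights dominate it: \<open>\<Sum>\<^sub>i x\<^sub>i\<^sup>2 \<le> max x \<cdot> \<Sum>\<^sub>i x\<^sub>i\<close> and \<open>\<Phi>(\<xi>) \<le> \<xi> \<cdot> max x\<close>. A codeword of minimum weight
  attains \<open>d\<close> for all three. Fewer than \<open>n - 2\<close> rows are impossible by counting the kernel.
\<close>

subsection \<open>The three weights\<close>

lemma length_decr_rearr [simp]: "length (decr_rearr (x :: real ^ 'n)) = CARD('n)"
  unfolding decr_rearr_def length_rev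
  by (metis mset_sorted_list_of_multiset size_image_mset size_mset size_mset_set)

lemma mset_decr_rearr: "mset (decr_rearr x) = image_mset (\<lambda>i. x $ i) (mset_set UNIV)"
  by (simp add: decr_rearr_def)

lemma set_decr_rearr: "set (decr_rearr x) = range (\<lambda>i. x $ i)"
  by (metis mset_decr_rearr finite finite_set_mset_mset_set set_image_mset set_mset_mset)

lemma sum_decr_rearr: "(\<Sum>i<CARD('n). decr_rearr x ! i) = (\<Sum>i\<in>UNIV. (x :: real ^ 'n) $ i)"
proof -
  have "(\<Sum>i<CARD('n). decr_rearr x ! i) = sum_list (decr_rearr x)"
    by (simp add: sum_list_sum_nth lessThan_atLeast0)
  also have "\<dots> = sum_mset (mset (decr_rearr x))"
    by (simp add: sum_mset_sum_list)
  finally show ?thesis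
    by (simp add: mset_decr_rearr sum_unfold_sum_mset)
qed

lemma decr_rearr_antimono:
  fixes x :: "real ^ 'n"
  assumes "i \<le> j" "j < CARD('n)"
  shows "decr_rearr x ! j \<le> decr_rearr x ! i"
proof -
  have "sorted (rev (decr_rearr x))"
    by (simp add: decr_rearr_def)
  then show ?thesis
    using assms by (simp add: sorted_rev_nth_mono)
qed

text \<open>Sorting puts the zeros first, so reversing brings the \<open>card S\<close> ones to the
  front.\<close>

lemma decr_rearr_indicator:
  fixes S :: "'n::finite set"
  assumes "i < card S"
  shows "decr_rearr (\<chi> i. of_bool (i \<in> S)) ! i = 1"
proof -
  let ?xs = "replicate (card (- S)) (0::real) @ replicate (card S) 1"
  have "mset_set (UNIV :: 'n set) = mset_set (- S) + mset_set S"
    by (metis Compl_disjoint2 Compl_partition2 finite mset_set_Union)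
  then have "image_mset (\<lambda>i. (\<chi> i. of_bool (i \<in> S)) $ i) (mset_set UNIV) =
      image_mset (\<lambda>i. 0::real) (mset_set (- S)) + image_mset (\<lambda>i. 1) (mset_set S)"
    by (auto intro!: arg_cong2[where f = "(+)"] image_mset_cong)
  also have "\<dots> = mset ?xs"
    by (simp add: image_mset_const_eq)
  finally have "decr_rearr (\<chi> i. of_bool (i \<in> S)) = rev (sort ?xs)"
    by (simp only: decr_rearr_def sorted_list_of_multiset_mset)
  also have "sort ?xs = ?xs"
    by (intro sorted_sort_id) (simp add: sorted_append)
  finally have "decr_rearr (\<chi> i. of_bool (i \<in> S)) = rev ?xs" .
  with assms show ?thesis
    by (simp add: nth_append)
qed

section \<open>The step function \<open>bsc_phi\<close> and its integrals\<close>

lemma bsc_phi_eq: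
  fixes x :: "real ^ 'n"
  assumes "k < CARD('n)" "real k < t" "t \<le> real (Suc k)"
  shows "bsc_phi x t = decr_rearr x ! k"
proof -
  have "nat \<lceil>t\<rceil> = Suc k"
    using assms by linarith
  then show ?thesis
    using assms by (auto simp: bsc_phi_def)
qed

lemma bsc_phi_antimono:
  fixes x :: "real ^ 'n"
  assumes "0 < s" "s \<le> t" "t \<le> real CARD('n)"
  shows "bsc_phi x t \<le> bsc_phi x s"
proof -
  have "nat \<lceil>s\<rceil> - 1 \<le> nat \<lceil>t\<rceil> - 1"
    using assms by (intro diff_le_mono nat_mono ceiling_mono)
  moreover have "nat \<lceil>t\<rceil> - 1 < CARD('n)"
    using assms by (simp add: less_diff_conv) linarith
  ultimately show ?thesis
    using assms by (simp add: bsc_phi_def decr_rearr_antimono)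
qed

lemma bsc_phi_le:
  fixes x :: "real ^ 'n"
  assumes "0 \<le> M" "\<And>i. x $ i \<le> M"
  shows "bsc_phi x t \<le> M"
proof -
  \<comment> \<open>The value 0 is the default outside the interval from 0 to n;
    \<open>0 \<le> M\<close> covers it.\<close>
  have "bsc_phi x t = 0 \<or> bsc_phi x t \<in> set (decr_rearr x)"
    unfolding bsc_phi_def by (auto intro!: nth_mem) linarith
  with assms show ?thesis
    by (auto simp: set_decr_rearr)
qed

lemma bsc_phi_has_integral:
  fixes x :: "real ^ 'n"
  assumes "k \<le> CARD('n)"
  shows "(bsc_phi x has_integral (\<Sum>i<k. decr_rearr x ! i)) {0..real k}"
  using assms
proof (induction k)
  case 0
  then show ?case
    using has_integral_refl(2)[of "bsc_phi x" 0] by simp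
next
  case (Suc k)
  have "((\<lambda>_. decr_rearr x ! k) has_integral decr_rearr x ! k) {real k..real (Suc k)}"
    using has_integral_const_real[of "decr_rearr x ! k" "real k" "real (Suc k)"] by simp
  \<comment> \<open>At the left endpoint \<open>real k\<close> the function still has the value of
    the previous step (the default 0 if \<open>k = 0\<close>), so this one point is
    exempted.\<close>
  then have "(bsc_phi x has_integral decr_rearr x ! k) {real k..real (Suc k)}"
    by (rule has_integral_spike_finite[of "{real k}", rotated 2])
      (use Suc.prems in \<open>auto intro!: bsc_phi_eq\<close>)
  with Suc show ?case
    by (auto intro!: has_integral_combine[where c = "real k"])
qed

lemma bsc_phi_integrable:
  fixes x :: "real ^ 'n"
  assumes "0 \<le> s" "t \<le> real CARD('n)"
  shows "bsc_phi x integrable_on {s..t}"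
  by (rule integrable_subinterval_real[OF has_integral_integrable[OF bsc_phi_has_integral[OF order_refl]]])
    (use assms in auto)

section \<open>The point where half of the mass is reached, and the BSC weight\<close>

lemma bsc_Phi_card: "bsc_Phi x (real CARD('n)) = (\<Sum>i\<in>UNIV. (x :: real ^ 'n) $ i)"
  using integral_unique[OF bsc_phi_has_integral[OF order_refl, of x]]
  by (simp add: bsc_Phi_def sum_decr_rearr)

lemma bsc_Phi_diff:
  fixes x :: "real ^ 'n"
  assumes "0 \<le> s" "s \<le> t" "t \<le> real CARD('n)"
  shows "bsc_Phi x t - bsc_Phi x s = integral {s..t} (bsc_phi x)"
  using Henstock_Kurzweil_Integration.integral_combine[where a = 0 and c = s and b = t and f = "bsc_phi x"] assms bsc_phi_integrable[of 0 t x]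
  by (simp add: bsc_Phi_def)

text \<open>The halving point is unique because \<open>bsc_phi x\<close> is non-increasing: if
  \<open>bsc_Phi x\<close> took the half value at \<open>s < t\<close>, then
  \<open>bsc_phi x\<close> would be non-positive from \<open>t\<close> on, and the other half of the
  mass could not be collected there.\<close>

lemma w_BSC_eq:
  fixes x :: "real ^ 'n"
  assumes pos: "0 < (\<Sum>i\<in>UNIV. x $ i)"
    and \<xi>: "\<xi> \<in> {0..real CARD('n)}" "bsc_Phi x \<xi> = (\<Sum>i\<in>UNIV. x $ i) / 2"
  shows "w_BSC x = 2 * \<xi>"
proof -
  let ?S = "\<Sum>i\<in>UNIV. x $ i"
  have no_less: False
    if s: "0 \<le> s" "bsc_Phi x s = ?S / 2" and t: "t \<le> real CARD('n)" "bsc_Phi x t = ?S / 2"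
      and "s < t" for s t
  proof -
    \<comment> \<open>Monotonicity of \<open>bsc_phi x\<close> is available only for positive
      arguments; 0 is excluded since \<open>bsc_Phi x 0 = 0\<close>, whereas half of the sum is
      positive.\<close>
    have "s \<noteq> 0"
      using s pos by (auto simp: bsc_Phi_def)
    with s \<open>s < t\<close> have "0 < s" "0 < t" by auto
    have "bsc_phi x t * (t - s) = integral {s..t} (\<lambda>_. bsc_phi x t)"
      using \<open>s < t\<close> by simp
    also have "\<dots> \<le> integral {s..t} (bsc_phi x)"
      using \<open>0 < s\<close> t by (intro integral_le bsc_phi_integrable) (auto intro: bsc_phi_antimono)
    also have "\<dots> = 0"
      using bsc_Phi_diff[of s t x] s t \<open>s < t\<close> by simp
    finally have "bsc_phi x t \<le> 0"
      using \<open>s < t\<close> by (simp add: mult_le_0_iff)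
    then have "bsc_phi x u \<le> 0" if "u \<in> {t..real CARD('n)}" for u
      using bsc_phi_antimono[of t u x] \<open>0 < t\<close> that by auto
    then have "integral {t..real CARD('n)} (bsc_phi x) \<le> integral {t..real CARD('n)} (\<lambda>_. 0)"
      using \<open>0 < t\<close> by (intro integral_le bsc_phi_integrable) auto
    then show False
      using bsc_Phi_diff[of t "real CARD('n)" x] \<open>0 < t\<close> t pos by (simp add: bsc_Phi_card)
  qed
  have "(THE \<xi>. \<xi> \<in> {0..real CARD('n)} \<and> bsc_Phi x \<xi> = bsc_Phi x (real CARD('n)) / 2) = \<xi>"
  proof (rule the_equality)
    fix \<eta> assume "\<eta> \<in> {0..real CARD('n)} \<and> bsc_Phi x \<eta> = bsc_Phi x (real CARD('n)) / 2"
    then show "\<eta> = \<xi>"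
      using \<xi> no_less[of \<eta> \<xi>] no_less[of \<xi> \<eta>]
      by (cases \<eta> \<xi> rule: linorder_cases) (simp_all add: bsc_Phi_card)
  qed (use \<xi> in \<open>simp add: bsc_Phi_card\<close>)
  then show ?thesis
    by (simp add: w_BSC_def)
qed

text \<open>Since \<open>bsc_phi x\<close> never exceeds \<open>M\<close>, collecting half of the
  sum, which is at least \<open>d * M / 2\<close>, takes an interval of length at least
  \<open>d / 2\<close>.\<close>

lemma w_BSC_ge:
  fixes x :: "real ^ 'n"
  assumes pos: "0 < M" and M: "\<And>i. x $ i \<le> M"
    and d: "0 < d" "d * M \<le> (\<Sum>i\<in>UNIV. x $ i)"
  shows "d \<le> w_BSC x"
proof -
  let ?S = "\<Sum>i\<in>UNIV. x $ i"
  have S: "0 < ?S"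
    using mult_pos_pos[OF d(1) pos] d(2) by linarith
  \<comment> \<open>\<open>bsc_Phi x\<close> is continuous, with value 0 at 0 and the whole sum at
    n.\<close>
  have "\<exists>\<xi>\<ge>0. \<xi> \<le> real CARD('n) \<and> bsc_Phi x \<xi> = ?S / 2"
  proof (rule IVT')
    show "continuous_on {0..real CARD('n)} (bsc_Phi x)"
      unfolding bsc_Phi_def
      by (rule indefinite_integral_continuous_1) (simp add: bsc_phi_integrable)
    show "?S / 2 \<le> bsc_Phi x (real CARD('n))"
      using S by (simp add: bsc_Phi_card)
  qed (use S in \<open>auto simp: bsc_Phi_def\<close>)
  then obtain \<xi> where \<xi>: "0 \<le> \<xi>" "\<xi> \<le> real CARD('n)" "bsc_Phi x \<xi> = ?S / 2"
    by blast
  have "?S / 2 = integral {0..\<xi>} (bsc_phi x)"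
    using \<xi> by (simp add: bsc_Phi_def)
  also have "\<dots> \<le> integral {0..\<xi>} (\<lambda>_. M)"
    using \<xi> bsc_phi_le[OF less_imp_le[OF pos] M] by (intro integral_le bsc_phi_integrable) auto
  also have "\<dots> = M * \<xi>"
    using \<xi> by simp
  finally have "d * M \<le> (2 * \<xi>) * M"
    using d by (simp add: mult.commute)
  then have "d \<le> 2 * \<xi>"
    using pos by simp
  then show ?thesis
    using w_BSC_eq[OF S] \<xi> by simp
qed

text \<open>The step function is 1 up to \<open>card S\<close>, so half of the mass
  \<open>card S\<close> is reached at \<open>card S / 2\<close>.\<close>

lemma w_BSC_indicator:
  fixes S :: "'n::finite set"
  assumes "S \<noteq> {}"
  shows "w_BSC (\<chi> i. of_bool (i \<in> S)) = real (card S)"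
proof -
  let ?x = "\<chi> i. of_bool (i \<in> S) :: real ^ 'n"
  have card: "card S \<le> CARD('n)" "0 < card S"
    using assms by (auto simp: card_mono card_gt_0_iff)
  have phi: "bsc_phi ?x t = 1" if t: "0 < t" "t \<le> real (card S)" for t
  proof -
    have "nat \<lceil>t\<rceil> - 1 < card S"
      using t by linarith
    with t card show ?thesis
      by (simp add: bsc_phi_def decr_rearr_indicator)
  qed
  have "((\<lambda>_. 1) has_integral real (card S) / 2) {0..real (card S) / 2}"
    using has_integral_const_real[of "1::real" 0 "real (card S) / 2"] by simp
  then have "(bsc_phi ?x has_integral real (card S) / 2) {0..real (card S) / 2}"
    by (rule has_integral_spike_finite[of "{0}", rotated 2]) (auto intro!: phi)
  then have "bsc_Phi ?x (real (card S) / 2) = real (card S) / 2"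
    by (simp add: bsc_Phi_def integral_unique)
  then have "w_BSC ?x = 2 * (real (card S) / 2)"
    using card by (intro w_BSC_eq) (auto simp: sum_of_bool_eq)
  then show ?thesis by simp
qed

section \<open>Lower bounds for the other two weights, and the minimum pseudoweight\<close>

lemma w_maxfrac_ge:
  fixes x :: "real ^ 'n"
  assumes nonneg: "\<And>i. 0 \<le> x $ i" and "x \<noteq> 0" and d: "\<And>l. d * x $ l \<le> (\<Sum>i\<in>UNIV. x $ i)"
  shows "d \<le> w_maxfrac x"
proof -
  let ?M = "Max (range (\<lambda>i. x $ i))"
  obtain l where l: "?M = x $ l"
    using Max_in[of "range (\<lambda>i. x $ i)"] finite[of UNIV] by blast
  obtain i where "x $ i \<noteq> 0"
    using \<open>x \<noteq> 0\<close> by (auto simp: vec_eq_iff)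
  then have "0 < x $ i"
    using nonneg[of i] by simp
  also have "x $ i \<le> ?M" by simp
  finally show ?thesis
    using d[of l] by (simp add: w_maxfrac_def l pos_le_divide_eq)
qed

lemma w_AWGNC_ge:
  fixes x :: "real ^ 'n"
  assumes nonneg: "\<And>i. 0 \<le> x $ i" and "x \<noteq> 0" and d: "\<And>l. d * x $ l \<le> (\<Sum>i\<in>UNIV. x $ i)"
  shows "d \<le> w_AWGNC x"
proof -
  obtain i where "x $ i \<noteq> 0"
    using \<open>x \<noteq> 0\<close> by (auto simp: vec_eq_iff)
  then have pos: "0 < (\<Sum>i\<in>UNIV. (x $ i)\<^sup>2)"
    by (intro sum_pos2[of _ i]) auto
  \<comment> \<open>The inequality for each \<open>l\<close> is weighted by \<open>x $ l\<close>,
    and the results are added.\<close>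
  have "d * (\<Sum>i\<in>UNIV. (x $ i)\<^sup>2) = (\<Sum>l\<in>UNIV. x $ l * (d * x $ l))"
    by (simp add: sum_distrib_left power2_eq_square algebra_simps)
  also have "\<dots> \<le> (\<Sum>l\<in>UNIV. x $ l * (\<Sum>i\<in>UNIV. x $ i))"
    by (intro sum_mono mult_left_mono d nonneg)
  also have "\<dots> = (\<Sum>i\<in>UNIV. x $ i)\<^sup>2"
    by (simp add: sum_distrib_right power2_eq_square)
  finally show ?thesis
    using pos by (simp add: w_AWGNC_def pos_le_divide_eq)
qed

text \<open>Treats all three weights at once: one linear inequality on the cone bounds each of them
  from below, and the indicator vector of \<open>S\<close> attains the bound for each.\<close>

lemma min_pseudoweight_eq:
  fixes H :: "(bit ^ 'n) list" and S :: "'n set"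
  assumes w: "w \<in> {w_AWGNC, w_BSC, w_maxfrac}" and "S \<noteq> {}"
    and S: "(\<chi> i. of_bool (i \<in> S)) \<in> fundamental_cone H"
    and cone: "\<And>x l. x \<in> fundamental_cone H \<Longrightarrow> real (card S) * x $ l \<le> (\<Sum>i\<in>UNIV. x $ i)"
  shows "min_pseudoweight w H = real (card S)"
  unfolding min_pseudoweight_def
proof (rule Least_equality)
  let ?x = "\<chi> i. of_bool (i \<in> S) :: real ^ 'n"
  have "card S \<noteq> 0" using \<open>S \<noteq> {}\<close> by simp
  have sum: "(\<Sum>i\<in>UNIV. ?x $ i) = real (card S)" "(\<Sum>i\<in>UNIV. (?x $ i)\<^sup>2) = real (card S)"
    by (simp_all add: power2_eq_square)
  moreover have "Max (range (\<lambda>i. ?x $ i)) = 1"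
    using \<open>S \<noteq> {}\<close> by (intro Max_eqI) auto
  ultimately have "w ?x = real (card S)"
    using w w_BSC_indicator[OF \<open>S \<noteq> {}\<close>] \<open>card S \<noteq> 0\<close> sum
    by (auto simp only: insert_iff empty_iff w_AWGNC_def w_maxfrac_def)
      (simp_all add: power2_eq_square)
  moreover have "?x \<noteq> 0"
    using \<open>S \<noteq> {}\<close> by (auto simp: vec_eq_iff)
  ultimately show "real (card S) \<in> w ` (fundamental_cone H - {0})"
    using S by (intro rev_image_eqI[of ?x]) auto
next
  fix y assume "y \<in> w ` (fundamental_cone H - {0})"
  then obtain x where x: "x \<in> fundamental_cone H" "x \<noteq> 0" "y = w x"
    by auto
  have nonneg: "0 \<le> x $ i" for i
    using x by (simp add: fundamental_cone_def)
  let ?M = "Max (range (\<lambda>i. x $ i))"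
  obtain l where l: "?M = x $ l"
    using Max_in[of "range (\<lambda>i. x $ i)"] finite[of UNIV] by blast
  have le: "x $ i \<le> x $ l" for i
    by (simp flip: l)
  obtain i where "x $ i \<noteq> 0"
    using \<open>x \<noteq> 0\<close> by (auto simp: vec_eq_iff)
  then have "0 < x $ l"
    using nonneg[of i] le[of i] by simp
  then have "real (card S) \<le> w_BSC x"
    using le cone[OF x(1)] \<open>S \<noteq> {}\<close>
    by (intro w_BSC_ge[where M = "x $ l"]) (auto simp: card_gt_0_iff)
  then show "real (card S) \<le> y"
    using w x w_maxfrac_ge[OF nonneg x(2) cone[OF x(1)]] w_AWGNC_ge[OF nonneg x(2) cone[OF x(1)]]
    by auto
qed

subsection \<open>Binary codes of dimension two\<close>

declare add_bit_eq_xor [simp del] mult_bit_eq_and [simp del] minus_bit_def [simp del]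

section \<open>Counting the kernel of a binary matrix\<close>

lemma UNIV_bit: "(UNIV :: bit set) = {0, 1}"
  by (auto intro: bit.exhaust)

lemma card_bit_vec: "CARD(bit ^ 'n) = 2 ^ CARD('n)"
  by (simp add: UNIV_bit numeral_2_eq_2)

lemma finite_bit_vec: "finite (S :: (bit ^ 'n) set)"
  by (rule finite_subset[OF subset_UNIV], rule card_ge_0_finite) (simp only: card_bit_vec, simp)

lemma mat_ker_Cons: "mat_ker (h # H) = {c \<in> mat_ker H. (\<Sum>i\<in>UNIV. h $ i * c $ i) = 0}"
  by (auto simp: mat_ker_def less_Suc_eq_0_disj)

lemma mat_ker_add:
  assumes "c \<in> mat_ker H" "c' \<in> mat_ker H"
  shows "c + c' \<in> mat_ker H"
  using assms by (simp add: mat_ker_def distrib_left sum.distrib)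

text \<open>Each further row at most halves the kernel: translation by a fixed vector that violates
  the new check maps the other violating vectors injectively into the new kernel.\<close>

lemma card_mat_ker: "2 ^ CARD('n) \<le> card (mat_ker H) * 2 ^ length (H :: (bit ^ 'n) list)"
proof (induction H)
  case Nil
  have "mat_ker [] = (UNIV :: (bit ^ 'n) set)"
    by (simp add: mat_ker_def)
  then show ?case
    by (simp only: card_bit_vec) simp
next
  case (Cons h H)
  let ?f = "\<lambda>c. \<Sum>i\<in>UNIV. h $ i * c $ i"
  let ?K = "mat_ker (h # H)" and ?L = "{c \<in> mat_ker H. ?f c = 1}"
  have "card ?L \<le> card ?K"
  proof (cases "?L = {}")
    case True
    then show ?thesis by (simp only: card.empty)
  next
    case False
    then obtain c0 where c0: "c0 \<in> ?L" by blast
    have "?f (c + c0) = ?f c + ?f c0" for c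
      by (simp add: distrib_left sum.distrib)
    with c0 have "(\<lambda>c. c + c0) ` ?L \<subseteq> ?K"
      by (auto simp: mat_ker_Cons mat_ker_add)
    then show ?thesis
      by (intro card_inj_on_le[of "\<lambda>c. c + c0"]) (auto simp: finite_bit_vec)
  qed
  moreover have "mat_ker H \<subseteq> ?K \<union> ?L"
    by (auto simp: mat_ker_Cons)
  then have "card (mat_ker H) \<le> card ?K + card ?L"
    by (intro order_trans[OF card_mono card_Un_le] finite_bit_vec)
  ultimately have "card (mat_ker H) * 2 ^ length H \<le> card ?K * 2 ^ length (h # H)"
    by simp
  with Cons.IH show ?case
    by linarith
qed

section \<open>A systematic basis, and the lower bound on the number of rows\<close>

lemma systematic_form:
  fixes C :: "(bit ^ 'n) set"
  assumes C: "vec.subspace C" and dim: "vec.dim C = 2"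
  obtains a b i0 i1 where "a $ i0 = 1" "a $ i1 = 0" "b $ i0 = 0" "b $ i1 = 1"
    "C = {c. \<forall>i. c $ i = c $ i0 * a $ i + c $ i1 * b $ i}"
proof -
  obtain B where B: "B \<subseteq> C" "vec.independent B" "C \<subseteq> vec.span B" "card B = 2"
    using vec.basis_exists[of C] dim by metis
  then obtain u v where uv: "B = {u, v}" "u \<noteq> v"
    by (auto simp: card_2_iff)
  have span: "C = vec.span {u, v}"
    using B C uv vec.span_minimal[of B C] by auto
  have "u \<noteq> 0"
    using B uv vec.dependent_zero by blast
  then obtain i0 where i0: "u $ i0 = 1"
    by (auto simp: vec_eq_iff)
  \<comment> \<open>Gaussian elimination: \<open>b\<close> is \<open>v\<close> with entry
    \<open>i0\<close> cleared by means of \<open>u\<close>, and below \<open>a\<close> is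
    \<open>u\<close> with entry \<open>i1\<close> cleared by means of \<open>b\<close>.\<close>
  define b where "b = v - v $ i0 *s u"
  have "v \<notin> vec.span {u}"
    using B uv by (simp add: vec.independent_insert insert_commute[of u])
  then have "b \<noteq> 0"
    using vec.span_scale[OF vec.span_base[of u "{u}"], of "v $ i0"] by (auto simp: b_def)
  then obtain i1 where i1: "b $ i1 = 1"
    by (auto simp: vec_eq_iff)
  define a where "a = u - u $ i1 *s b"
  have b_i0: "b $ i0 = 0"
    by (simp add: b_def i0)
  have a: "a $ i0 = 1" "a $ i1 = 0"
    by (simp_all add: a_def i0 i1 b_i0)
  \<comment> \<open>With respect to \<open>a\<close> and \<open>b\<close>, the coefficients of a
    codeword are its own entries at \<open>i0\<close> and \<open>i1\<close>.\<close>
  let ?D = "{c. \<forall>i. c $ i = c $ i0 * a $ i + c $ i1 * b $ i}"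
  have "vec.subspace ?D"
  proof (rule vec.subspaceI)
    fix x y assume "x \<in> ?D" "y \<in> ?D"
    then have x: "x $ i = x $ i0 * a $ i + x $ i1 * b $ i"
      and y: "y $ i = y $ i0 * a $ i + y $ i1 * b $ i" for i
      by blast+
    have "(x + y) $ i = (x + y) $ i0 * a $ i + (x + y) $ i1 * b $ i" for i
      unfolding vector_add_component by (subst x[of i], subst y[of i]) (simp add: algebra_simps)
    then show "x + y \<in> ?D" by blast
  next
    fix k x assume "x \<in> ?D"
    then have x: "x $ i = x $ i0 * a $ i + x $ i1 * b $ i" for i
      by blast
    have "(k *s x) $ i = (k *s x) $ i0 * a $ i + (k *s x) $ i1 * b $ i" for i
      unfolding vector_smult_component by (subst x[of i]) (simp add: algebra_simps)
    then show "k *s x \<in> ?D" by blast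
  qed simp
  moreover have "u $ i = u $ i0 * a $ i + u $ i1 * b $ i" for i
    by (simp add: a_def i0)
  then have "u \<in> ?D" by blast
  moreover have v: "v $ i = b $ i + v $ i0 * u $ i" for i
    by (simp add: b_def)
  have v1: "v $ i1 = 1 + v $ i0 * u $ i1"
    using v[of i1] i1 by simp
  have "v $ i = v $ i0 * a $ i + v $ i1 * b $ i" for i
    by (subst v[of i], subst v1) (simp add: a_def algebra_simps)
  then have "v \<in> ?D" by blast
  ultimately have "{u, v} \<subseteq> ?D"
    by blast
  then have "C \<subseteq> ?D"
    unfolding span using \<open>vec.subspace ?D\<close> by (rule vec.span_minimal)
  moreover have "b \<in> C" "a \<in> C"
    using B uv C unfolding a_def b_def
    by (auto intro!: vec.subspace_diff vec.subspace_scale)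
  then have "c \<in> C" if "c \<in> ?D" for c
  proof -
    have "c = c $ i0 *s a + c $ i1 *s b"
      using that unfolding vec_eq_iff vector_add_component vector_smult_component by blast
    then show ?thesis
      using C \<open>a \<in> C\<close> \<open>b \<in> C\<close> by (metis vec.subspace_add vec.subspace_scale)
  qed
  ultimately have "C = ?D"
    by blast
  then show thesis
    by (rule that[OF a b_i0 i1])
qed

text \<open>A codeword is determined by its entries at \<open>i0\<close> and \<open>i1\<close>, so
  the kernel has at most 4 elements; with m rows it has at least 2 to the power n - m.\<close>

lemma parity_check_length:
  fixes C :: "(bit ^ 'n) set"
  assumes "vec.subspace C" "vec.dim C = 2" "is_parity_check H C"
  shows "CARD('n) - 2 \<le> length H"
proof -
  obtain a b i0 i1 where "a $ i0 = 1" "a $ i1 = 0" "b $ i0 = 0" "b $ i1 = 1"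
    and C: "C = {c. \<forall>i. c $ i = c $ i0 * a $ i + c $ i1 * b $ i}"
    by (rule systematic_form[OF assms(1,2)])
  have "card C \<le> card (UNIV :: (bit \<times> bit) set)"
  proof (rule card_inj_on_le)
    show "inj_on (\<lambda>c. (c $ i0, c $ i1)) C"
    proof (rule inj_onI)
      fix x y assume "x \<in> C" "y \<in> C" and eq: "(x $ i0, x $ i1) = (y $ i0, y $ i1)"
      then have "x $ i = x $ i0 * a $ i + x $ i1 * b $ i" "y $ i = y $ i0 * a $ i + y $ i1 * b $ i" for i
        unfolding C by blast+
      then show "x = y"
        using eq by (metis Pair_inject vec_eq_iff)
    qed
  qed (simp_all add: finite_prod UNIV_bit)
  also have "\<dots> = 4"
    by (simp add: card_prod UNIV_bit)
  finally have "card (mat_ker H) * 2 ^ length H \<le> 2 ^ (length H + 2)"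
    using assms(3) by (simp add: is_parity_check_def power_add)
  then have "(2::nat) ^ CARD('n) \<le> 2 ^ (length H + 2)"
    using card_mat_ker[of H] by linarith
  then show ?thesis
    by (subst (asm) power_increasing_iff) auto
qed

section \<open>The minimum distance as the minimum weight of a nonzero codeword\<close>

lemma finite_hamming_dists:
  fixes C :: "(bit ^ 'n) set"
  shows "finite {hamming_dist x y | x y. x \<in> C \<and> y \<in> C \<and> x \<noteq> y}"
proof -
  have "{hamming_dist x y | x y. x \<in> C \<and> y \<in> C \<and> x \<noteq> y} \<subseteq>
      (\<lambda>(x, y). hamming_dist x y) ` (C \<times> C)"
    by auto
  then show ?thesis
    by (rule finite_subset) (simp add: finite_bit_vec)
qed

lemma min_dist_attained:
  fixes C :: "(bit ^ 'n) set"
  assumes "vec.subspace C" "a \<in> C" "a \<noteq> 0"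
  obtains c where "c \<in> C" "c \<noteq> 0" "min_dist C = card {i. c $ i = 1}"
proof -
  let ?D = "{hamming_dist x y | x y. x \<in> C \<and> y \<in> C \<and> x \<noteq> y}"
  note finite_hamming_dists[of C]
  moreover have "hamming_dist a 0 \<in> ?D"
    using assms vec.subspace_0 by blast
  ultimately have "min_dist C \<in> ?D"
    unfolding min_dist_def by (intro Min_in) auto
  then obtain x y where xy: "x \<in> C" "y \<in> C" "x \<noteq> y" "min_dist C = hamming_dist x y"
    by auto
  have "x $ i \<noteq> y $ i \<longleftrightarrow> (x - y) $ i = 1" for i
    by (cases "x $ i"; cases "y $ i") (simp_all add: minus_bit_def)
  then have "min_dist C = card {i. (x - y) $ i = 1}"
    using xy by (simp only: hamming_dist_def)
  then show thesis
    using xy assms by (intro that[of "x - y"]) (simp_all add: vec.subspace_diff)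
qed

lemma min_dist_le:
  fixes C :: "(bit ^ 'n) set"
  assumes "vec.subspace C" "c \<in> C" "c \<noteq> 0"
  shows "min_dist C \<le> card {i. c $ i = 1}"
proof -
  let ?D = "{hamming_dist x y | x y. x \<in> C \<and> y \<in> C \<and> x \<noteq> y}"
  note finite_hamming_dists[of C]
  moreover have "hamming_dist c 0 \<in> ?D"
    using assms vec.subspace_0 by blast
  ultimately have "min_dist C \<le> hamming_dist c 0"
    unfolding min_dist_def by (intro Min_le)
  then show ?thesis
    by (simp add: hamming_dist_def)
qed

section \<open>Codewords in the cone, and a weighted triangle inequality\<close>

lemma codeword_in_cone:
  fixes H :: "(bit ^ 'n) list"
  assumes "c \<in> mat_ker H"
  shows "(\<chi> i. of_bool (i \<in> {i. c $ i = 1})) \<in> fundamental_cone H"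
proof -
  have "of_bool (c $ l = 1) \<le> (\<Sum>i\<in>row_supp H j - {l}. of_bool (c $ i = 1) :: real)"
    if j: "j < length H" and l: "l \<in> row_supp H j" for j l
  proof (cases "\<exists>i\<in>row_supp H j - {l}. c $ i = 1")
    case True
    then obtain i where "i \<in> row_supp H j - {l}" "c $ i = 1" by blast
    then have "(1::real) \<le> (\<Sum>i\<in>row_supp H j - {l}. of_bool (c $ i = 1))"
      using member_le_sum[of i "row_supp H j - {l}" "\<lambda>i. of_bool (c $ i = 1) :: real"] by simp
    then show ?thesis
      by (rule order_trans[rotated]) simp
  next
    case False
    \<comment> \<open>If \<open>c\<close> vanishes on the rest of the row, the check reduces to its
      term at \<open>l\<close>, which forces \<open>c $ l = 0\<close>: no check meets a codeword in
      exactly one 1.\<close>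
    then have "H ! j $ i * c $ i = 0" if "i \<noteq> l" for i
      using that by (cases "c $ i"; cases "H ! j $ i") (auto simp: row_supp_def)
    then have "(\<Sum>i\<in>UNIV. H ! j $ i * c $ i) = H ! j $ l * c $ l"
      by (subst sum.remove[of UNIV l]) (simp_all add: sum.neutral)
    with assms j l have "c $ l = 0"
      by (simp add: mat_ker_def row_supp_def)
    then show ?thesis
      by (simp add: sum_nonneg)
  qed
  then show ?thesis
    by (simp add: fundamental_cone_def)
qed

text \<open>With \<open>m = min q r\<close>, the last two terms are at least
  \<open>m * (\<beta> + \<gamma>)\<close>, hence at least \<open>m * \<alpha>\<close>, and
  \<open>d \<le> p + m\<close>.\<close>

lemma triangle_weighted_le:
  fixes \<alpha> \<beta> \<gamma> p q r d :: real
  assumes "0 \<le> \<alpha>" "0 \<le> \<beta>" "0 \<le> \<gamma>" "\<alpha> \<le> \<beta> + \<gamma>" "0 \<le> q" "0 \<le> r" "d \<le> p + q" "d \<le> p + r"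
  shows "d * \<alpha> \<le> p * \<alpha> + q * \<beta> + r * \<gamma>"
proof -
  define m where "m = min q r"
  have "d * \<alpha> \<le> (p + m) * \<alpha>"
    using assms by (intro mult_right_mono) (auto simp: m_def)
  also have "\<dots> \<le> p * \<alpha> + m * (\<beta> + \<gamma>)"
    using assms by (simp add: distrib_right mult_left_mono m_def)
  also have "\<dots> \<le> p * \<alpha> + q * \<beta> + r * \<gamma>"
    using mult_right_mono[of m q \<beta>] mult_right_mono[of m r \<gamma>] assms
    by (simp add: m_def distrib_left)
  finally show ?thesis .
qed

section \<open>Parity-check matrices given by the supports of their rows\<close>

definition indicator_row :: "'n set \<Rightarrow> bit ^ 'n" where
  "indicator_row S = (\<chi> i. of_bool (i \<in> S))"

lemma mat_ker_indicator_rows: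
  "mat_ker (map indicator_row Ss) = {c. \<forall>S\<in>set Ss. (\<Sum>i\<in>S. c $ i) = 0}"
proof -
  have "(\<Sum>i\<in>UNIV. indicator_row S $ i * c $ i) = (\<Sum>i\<in>S. c $ i)" for S and c :: "bit ^ 'a"
    by (simp add: indicator_row_def of_bool_def if_distrib[of "\<lambda>x. x * _"] sum.If_cases cong: if_cong)
  then show ?thesis
    by (auto simp: mat_ker_def all_set_conv_all_nth)
qed

lemma cone_indicator_rows:
  assumes "x \<in> fundamental_cone (map indicator_row Ss)" "S \<in> set Ss" "l \<in> S"
  shows "x $ l \<le> (\<Sum>i\<in>S - {l}. x $ i)"
proof -
  obtain j where "j < length Ss" "Ss ! j = S"
    using assms(2) by (metis in_set_conv_nth)
  moreover from this have "row_supp (map indicator_row Ss) j = S"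
    by (simp add: row_supp_def indicator_row_def)
  ultimately show ?thesis
    using assms by (auto simp: fundamental_cone_def)
qed

section \<open>The matrix with n - 2 rows and the inequality on its cone\<close>

lemma parity_check_cone_bound:
  fixes C :: "(bit ^ 'n) set"
  assumes sub: "vec.subspace C" and dim: "vec.dim C = 2"
  obtains H where "is_parity_check H C" "length H = CARD('n) - 2"
    "\<And>x l. x \<in> fundamental_cone H \<Longrightarrow> real (min_dist C) * x $ l \<le> (\<Sum>i\<in>UNIV. x $ i)"
proof -
  obtain a b i0 i1 where i0_i1: "a $ i0 = 1" "a $ i1 = 0" "b $ i0 = 0" "b $ i1 = 1"
    and C: "C = {c. \<forall>i. c $ i = c $ i0 * a $ i + c $ i1 * b $ i}"
    by (rule systematic_form[OF assms])
  note i0 = i0_i1(1,3) and i1 = i0_i1(2,4)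
  \<comment> \<open>\<open>k\<close> is a coordinate of type (1, 1) if there is one, and arbitrary
    otherwise.\<close>
  obtain k where k: "\<And>i. a $ i = 1 \<Longrightarrow> b $ i = 1 \<Longrightarrow> a $ k = 1 \<and> b $ k = 1"
    by metis
  \<comment> \<open>The rows reduce coordinates of the same type \<open>(a $ i, b $ i)\<close> to a single representative (\<open>i0\<close>, \<open>i1\<close>
    or \<open>k\<close>), and row \<open>k\<close> is the only one of weight three. Attaching every coordinate of type \<open>(1, 1)\<close>
    to \<open>{i0, i1}\<close> directly would make the cone too large.\<close>
  define R where "R i =
    (if a $ i = 0 then if b $ i = 0 then {i} else {i, i1}
     else if b $ i = 0 then {i, i0} else if i = k then {i, i0, i1} else {i, k})" for i
  \<comment> \<open>\<open>i0\<close> and \<open>i1\<close> get no row of their own: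
    \<open>R i0\<close> and \<open>R i1\<close> are singletons and would force these entries to be
    0.\<close>
  obtain is' where is': "set is' = UNIV - {i0, i1}" "distinct is'"
    using finite_distinct_list[of "UNIV - {i0, i1}"] by auto
  have "i0 \<noteq> i1"
    using i0 i1 by auto
  define H where "H = map indicator_row (map R is')"
  show thesis
  proof
    have "length is' = card (UNIV - {i0, i1})"
      using is' by (metis distinct_card)
    then show "length H = CARD('n) - 2"
      using \<open>i0 \<noteq> i1\<close> by (simp add: H_def card_Diff_subset)
    have eq_iff: "x + y = 0 \<longleftrightarrow> x = y" for x y :: bit
      by (cases x; cases y) simp_all
    \<comment> \<open>The check \<open>R i\<close> is solved for entry \<open>i\<close>. Excluding
      \<open>i0\<close> and \<open>i1\<close> keeps the listed elements of \<open>R i\<close>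
      distinct, so no term of the sum collapses.\<close>
    have row_sum: "(\<Sum>j\<in>R i. c $ j) = 0 \<longleftrightarrow> c $ i =
        (if a $ i = 0 then if b $ i = 0 then 0 else c $ i1
         else if b $ i = 0 then c $ i0 else if i = k then c $ i0 + c $ i1 else c $ k)"
      if "i \<noteq> i0" "i \<noteq> i1" for c :: "bit ^ 'n" and i
      using that \<open>i0 \<noteq> i1\<close> by (cases "i = k") (simp_all add: R_def eq_iff)
    have "mat_ker H = {c. \<forall>i\<in>UNIV - {i0, i1}. (\<Sum>j\<in>R i. c $ j) = 0}"
      unfolding H_def mat_ker_indicator_rows by (simp add: is')
    also have "\<dots> = C"
    proof (intro set_eqI iffI)
      fix c :: "bit ^ 'n" assume "c \<in> {c. \<forall>i\<in>UNIV - {i0, i1}. (\<Sum>j\<in>R i. c $ j) = 0}"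
      then have c: "c $ i = (if a $ i = 0 then if b $ i = 0 then 0 else c $ i1
         else if b $ i = 0 then c $ i0 else if i = k then c $ i0 + c $ i1 else c $ k)"
        if "i \<noteq> i0" "i \<noteq> i1" for i
        using row_sum[OF that, of c] that by blast
      have ck: "c $ k = c $ i0 + c $ i1" if "a $ k = 1" "b $ k = 1"
      proof -
        have "k \<noteq> i0" "k \<noteq> i1"
          using that i0 i1 by auto
        with c[of k] that show ?thesis by simp
      qed
      have "c $ i = c $ i0 * a $ i + c $ i1 * b $ i" for i
      proof (cases "i = i0 \<or> i = i1")
        case False
        then have i: "i \<noteq> i0" "i \<noteq> i1" by auto
        show ?thesis
        proof (cases "a $ i = 1 \<and> b $ i = 1")
          case True
          then have "c $ k = c $ i0 + c $ i1"
            using k[of i] ck by blast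
          moreover have "c $ i = c $ k"
            using c[OF i] True calculation by (simp split: if_splits)
          ultimately show ?thesis
            using True by simp
        next
          case False
          then show ?thesis
            using c[OF i] by (cases "a $ i"; cases "b $ i") simp_all
        qed
      qed (use i0 i1 in auto)
      then show "c \<in> C" unfolding C by blast
    next
      fix c :: "bit ^ 'n" assume "c \<in> C"
      then have c: "c $ i = c $ i0 * a $ i + c $ i1 * b $ i" for i
        unfolding C by blast
      have "(\<Sum>j\<in>R i. c $ j) = 0" if "i \<noteq> i0" "i \<noteq> i1" for i
        unfolding row_sum[OF that]
        using k[of i] c[of i] c[of k] by (cases "a $ i"; cases "b $ i") simp_all
      then show "c \<in> {c. \<forall>i\<in>UNIV - {i0, i1}. (\<Sum>j\<in>R i. c $ j) = 0}" by simp
    qed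
    finally show "is_parity_check H C"
      by (simp add: is_parity_check_def)
    fix x l assume x: "x \<in> fundamental_cone H"
    have nonneg: "0 \<le> x $ i" for i
      using x by (simp add: fundamental_cone_def)
    have row: "x $ j \<le> (\<Sum>i\<in>R i - {j}. x $ i)" if "i \<noteq> i0" "i \<noteq> i1" "j \<in> R i" for i j
      using that x is' by (intro cone_indicator_rows[of x "map R is'"]) (auto simp: H_def)
    let ?T = "\<lambda>p q. {i. a $ i = p \<and> b $ i = q}"
    define \<alpha> where "\<alpha> = x $ i0"
    define \<beta> where "\<beta> = x $ i1"
    \<comment> \<open>If there is no coordinate of type \<open>(1, 1)\<close>, the value \<open>\<alpha> + \<beta>\<close> keeps the triangle inequalities valid
      and is multiplied by \<open>r = 0\<close> below.\<close>
    define \<gamma> where "\<gamma> = (if ?T 1 1 = {} then \<alpha> + \<beta> else x $ k)"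
    \<comment> \<open>The row \<open>{i}\<close> bounds \<open>x $ i\<close> by an empty
      sum.\<close>
    have x0: "x $ i = 0" if "i \<in> ?T 0 0" for i
      using row[of i i] nonneg[of i] that i0 i1 by (force simp: R_def)
    \<comment> \<open>A row of weight two gives inequalities in both directions, hence
      equality.\<close>
    have x\<alpha>: "x $ i = \<alpha>" if "i \<in> ?T 1 0" for i
    proof (cases "i = i0")
      case False
      then have "i \<noteq> i1" "R i = {i, i0}" "R i - {i} = {i0}" "R i - {i0} = {i}"
        using that i0 i1 by (auto simp: R_def)
      then show ?thesis
        using row[of i i] row[of i i0] False by (simp add: \<alpha>_def)
    qed (simp add: \<alpha>_def)
    have x\<beta>: "x $ i = \<beta>" if "i \<in> ?T 0 1" for i
    proof (cases "i = i1")
      case False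
      then have "i \<noteq> i0" "R i = {i, i1}" "R i - {i} = {i1}" "R i - {i1} = {i}"
        using that i0 i1 by (auto simp: R_def)
      then show ?thesis
        using row[of i i] row[of i i1] False by (simp add: \<beta>_def)
    qed (simp add: \<beta>_def)
    have x\<gamma>: "x $ i = \<gamma>" if "i \<in> ?T 1 1" for i
    proof -
      have "?T 1 1 \<noteq> {}"
        using that by blast
      then have "\<gamma> = x $ k"
        by (simp only: \<gamma>_def if_False)
      moreover have "x $ i = x $ k"
      proof (cases "i = k")
        case False
        then have "i \<noteq> i0" "i \<noteq> i1" "R i = {i, k}" "R i - {i} = {k}" "R i - {k} = {i}"
          using that i0 i1 by (auto simp: R_def)
        then show ?thesis
          using row[of i i] row[of i k] by simp
      qed simp
      ultimately show ?thesis by simp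
    qed
    have triangle: "\<alpha> \<le> \<beta> + \<gamma> \<and> \<beta> \<le> \<alpha> + \<gamma> \<and> \<gamma> \<le> \<alpha> + \<beta>"
    proof (cases "?T 1 1 = {}")
      case True
      then show ?thesis
        using nonneg by (simp add: \<gamma>_def \<alpha>_def \<beta>_def)
    next
      case False
      then have "a $ k = 1" "b $ k = 1"
        using k by auto
      \<comment> \<open>The three cone inequalities of the row \<open>{k, i0, i1}\<close> are the
        triangle inequalities.\<close>
      then have "k \<noteq> i0" "k \<noteq> i1" "R k = {k, i0, i1}"
        "R k - {k} = {i0, i1}" "R k - {i0} = {k, i1}" "R k - {i1} = {k, i0}"
        using i0 i1 \<open>i0 \<noteq> i1\<close> by (auto simp: R_def)
      moreover have "\<gamma> = x $ k"
        using False by (simp only: \<gamma>_def if_False)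
      ultimately show ?thesis
        using row[of k k] row[of k i0] row[of k i1] \<open>i0 \<noteq> i1\<close> by (simp add: \<alpha>_def \<beta>_def)
    qed
    define p where "p = real (card (?T 1 0))"
    define q where "q = real (card (?T 0 1))"
    define r where "r = real (card (?T 1 1))"
    have x_eq: "x $ i = \<alpha> * of_bool (i \<in> ?T 1 0) + \<beta> * of_bool (i \<in> ?T 0 1) + \<gamma> * of_bool (i \<in> ?T 1 1)" for i
      using x0[of i] x\<alpha>[of i] x\<beta>[of i] x\<gamma>[of i] by (cases "a $ i"; cases "b $ i") simp_all
    have sum: "(\<Sum>i\<in>UNIV. x $ i) = p * \<alpha> + q * \<beta> + r * \<gamma>"
      unfolding x_eq by (simp add: sum.distrib p_def q_def r_def flip: sum_distrib_left)
    have card_Un: "card S = card T + card U"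
      if "S = T \<union> U" "T \<inter> U = {}" for S T U :: "'n set"
      using that by (simp add: card_Un_disjoint)
    \<comment> \<open>The nonzero codewords \<open>a\<close>, \<open>b\<close>, \<open>a + b\<close>
      have weights \<open>p + r\<close>, \<open>q + r\<close>, \<open>p + q\<close>, and each weight
      is at least the minimum distance.\<close>
    have "a \<in> C" "b \<in> C" "a \<noteq> 0" "b \<noteq> 0"
      using i0 i1 by (auto simp: C vec_eq_iff)
    moreover have "a + b \<in> C" "a + b \<noteq> 0"
      using vec.subspace_add[OF sub \<open>a \<in> C\<close> \<open>b \<in> C\<close>] i0 by (auto simp: vec_eq_iff intro!: exI[of _ i0])
    moreover have "card {i. a $ i = 1} = card (?T 1 0) + card (?T 1 1)"
      by (rule card_Un) (auto intro: bit.exhaust)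
    moreover have "card {i. b $ i = 1} = card (?T 0 1) + card (?T 1 1)"
      by (rule card_Un) (auto intro: bit.exhaust)
    moreover have add_eq_1: "y + z = 1 \<longleftrightarrow> y = 1 \<and> z = 0 \<or> y = 0 \<and> z = 1" for y z :: bit
      by (cases y; cases z) simp_all
    have "card {i. (a + b) $ i = 1} = card (?T 1 0) + card (?T 0 1)"
      by (rule card_Un) (auto simp: add_eq_1)
    ultimately have d: "real (min_dist C) \<le> p + r" "real (min_dist C) \<le> q + r" "real (min_dist C) \<le> p + q"
      using min_dist_le[OF sub, of a] min_dist_le[OF sub, of b] min_dist_le[OF sub, of "a + b"]
      by (auto simp: p_def q_def r_def)
    have nonneg': "0 \<le> \<alpha>" "0 \<le> \<beta>" "0 \<le> \<gamma>" "0 \<le> p" "0 \<le> q" "0 \<le> r"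
      using nonneg by (auto simp: \<alpha>_def \<beta>_def \<gamma>_def p_def q_def r_def)
    have "x $ l \<in> {0, \<alpha>, \<beta>, \<gamma>}"
      unfolding x_eq[of l] by (cases "a $ l"; cases "b $ l") simp_all
    moreover have "0 \<le> p * \<alpha> + q * \<beta> + r * \<gamma>"
      using nonneg' by simp
    \<comment> \<open>Each value is bounded by its own triangle inequality and the two distance
      bounds that contain its multiplicity.\<close>
    moreover have "real (min_dist C) * \<alpha> \<le> p * \<alpha> + q * \<beta> + r * \<gamma>"
      using triangle_weighted_le[of \<alpha> \<beta> \<gamma> q r "real (min_dist C)" p] nonneg' triangle d by simp
    moreover have "real (min_dist C) * \<beta> \<le> p * \<alpha> + q * \<beta> + r * \<gamma>"
      using triangle_weighted_le[of \<beta> \<alpha> \<gamma> p r "real (min_dist C)" q] nonneg' triangle d by simp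
    moreover have "real (min_dist C) * \<gamma> \<le> p * \<alpha> + q * \<beta> + r * \<gamma>"
      using triangle_weighted_le[of \<gamma> \<alpha> \<beta> p q "real (min_dist C)" r] nonneg' triangle d by simp
    ultimately show "real (min_dist C) * x $ l \<le> (\<Sum>i\<in>UNIV. x $ i)"
      unfolding sum by auto
  qed
qed

theorem corollary4p3:
  fixes C :: "(bit ^ 'n) set"
  assumes "vec.subspace C" and "vec.dim C = 2"
  shows "\<forall>w \<in> {w_AWGNC, w_BSC, w_maxfrac}.
           redundancy w C = enat (CARD('n) - 2) \<and> class_at_least_2 w C"
proof
  fix w :: "real ^ 'n \<Rightarrow> real"
  assume w: "w \<in> {w_AWGNC, w_BSC, w_maxfrac}"
  obtain H where H: "is_parity_check H C" "length H = CARD('n) - 2"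
    and cone: "\<And>x l. x \<in> fundamental_cone H \<Longrightarrow> real (min_dist C) * x $ l \<le> (\<Sum>i\<in>UNIV. x $ i)"
    using parity_check_cone_bound[OF assms] by metis
  have "\<exists>a\<in>C. a \<noteq> 0"
    using assms(2) vec.dim_eq_0[of C] by auto
  then obtain c where c: "c \<in> C" "c \<noteq> 0" "min_dist C = card {i. c $ i = 1}"
    using min_dist_attained[OF assms(1)] by metis
  have "min_pseudoweight w H = real (card {i. c $ i = 1})"
  proof (rule min_pseudoweight_eq[OF w])
    show "{i. c $ i = 1} \<noteq> {}"
      using c by (auto simp: vec_eq_iff)
    show "(\<chi> i. of_bool (i \<in> {i. c $ i = 1})) \<in> fundamental_cone H"
      using c H by (intro codeword_in_cone) (simp add: is_parity_check_def)
  qed (use cone c in simp)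
  then have "redundancy w C \<le> enat (CARD('n) - 2)"
    unfolding redundancy_def using H c by (intro Inf_lower) force
  moreover have "enat (CARD('n) - 2) \<le> redundancy w C"
    unfolding redundancy_def using parity_check_length[OF assms] by (intro Inf_greatest) auto
  ultimately have "redundancy w C = enat (CARD('n) - 2)"
    by (rule antisym)
  \<comment> \<open>Once the redundancy equals n minus the dimension, a code outside class 3 is in
    class 2 by definition.\<close>
  then show "redundancy w C = enat (CARD('n) - 2) \<and> class_at_least_2 w C"
    using assms(2) by (simp add: class_at_least_2_def class2_def)
qed

end
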